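(* Let $F\in\mathbb{H}^\infty_d\otimes\mathcal{L}(\mathcal{F},\mathcal{J})$ and $G\in\mathbb{H}^\infty_d\otimes\mathcal{L}(\mathcal{G},\mathcal{J})$ be operator-valued left multipliers. If $F,G$ are injective, then so is $H:=F\wedge G\in\mathbb{H}^\infty_d\otimes\mathcal{L}(\mathcal{H},\mathcal{J})$, and $$\begin{pmatrix}H(L)\\-H(L)\end{pmatrix}=\begin{pmatrix}F(L)&0\\0&G(L)\end{pmatrix}\Gamma(L),$$ where $\Gamma(L):\mathbb{H}^2_d\otimes\mathcal{H}\to\mathbb{H}^2_d\otimes(\mathcal{F}\oplus\mathcal{G})$ is an inner left multiplier with $\mathrm{Ran}(\Gamma(L))=\mathrm{Ker}((F\vee G)(L))$.
   Context: Let $d\in\mathbb{N}$. The NC Hardy space (full Fock space) $\mathbb{H}^2_d$ is the Hilbert space of formal power series in $d$ non-commuting variables $\mathfrak{z}_1,\dots,\mathfrak{z}_d$ with square-summable coefficients. $R_k$ is the isometry of right multiplication by $\mathfrak{z}_k$, $R=(R_1,\dots,R_d)$. For Hilbert spaces $\mathcal{F},\mathcal{J}$, $\mathbb{H}^\infty_d\otimes\mathcal{L}(\mathcal{F},\mathcal{J})$ is the space of operator-valued left multipliers: equivalently the bounded operators $F=F(L):\mathbb{H}^2_d\otimes\mathcal{F}\to\mathbb{H}^2_d\otimes\mathcal{J}$ with $F(L)(R_k\otimes I_{\mathcal{F}})=(R_k\otimes I_{\mathcal{J}})F(L)$ for all $k$. A left multiplier is inner if it is an isometry, and injective if $F(L)$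 is an injective operator. $\mathscr{M}^L(F)$ is the space $\mathrm{Ran}(F(L))$ with norm $\|F(L)x\|_F:=\|P_{\mathrm{Ker}(F(L))^\perp}x\|$. $\mathscr{M}^L(F)\wedge\mathscr{M}^L(G)$ is $\mathscr{M}^L(F)\cap\mathscr{M}^L(G)$ with norm $\|h\|^2=\|h\|_F^2+\|h\|_G^2$. $F\vee G:=(F,G)\in\mathbb{H}^\infty_d\otimes\mathcal{L}(\mathcal{F}\oplus\mathcal{G},\mathcal{J})$ (row). $F\wedge G:=H\in\mathbb{H}^\infty_d\otimes\mathcal{L}(\mathcal{H},\mathcal{J})$ is the left multiplier with $\mathscr{M}^L(H)=\mathscr{M}:=\mathscr{M}^L(F)\wedge\mathscr{M}^L(G)$ given by the de Branges–Beurling construction $H(L)=\mathrm{e}P_{\mathscr{M}}U$, where $\mathrm{e}:\mathscr{M}\hookrightarrow\mathbb{H}^2_d\otimes\mathcal{J}$ is the embedding, $\hat X$ on $\hat{\mathscr{M}}\supseteq\mathscr{M}$ is the minimal row isometric dilation of the row contraction $X=(R\otimes I_{\mathcal{J}})|_{\mathscr{M}}$, $P_{\mathscr{M}}:\hat{\mathscr{M}}\to\mathscr{M}$ is the orthogonal projection, and $U:\mathbb{H}^2_d\otimes\mathcal{H}\to\hat{\mathscr{M}}$ is a unitary intertwining $R\otimes I_{\mathcal{H}}$ with $\hat X$. (A row isometric dilation of $X$ is a tuple of isometries $\hat X_k$ with pairwise orthogonal ranges on a larger space satisfying $P_{\mathscr{M}}\hat X^\alpha|_{\mathscr{M}}=X^\alpha$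 for all words $\alpha$ in $\{1,\dots,d\}$; minimal means that $\hat{\mathscr{M}}$ is the closed span of the $\hat X^\alpha\mathscr{M}$.) *)

theory Defs
  imports "HOL-Analysis.Analysis"
begin

section \<open>Complex Hilbert spaces\<close>

text \<open>
  The class extends real Hilbert spaces, so that the norm, the metric, completeness and
  \<^const>\<open>bounded_linear\<close> are those of the library. The complex inner product is conjugate-linear
  in its first argument and its real part is the real inner product.
\<close>

class complex_hilbert = real_inner + complete_space +
  fixes scaleC :: "complex \<Rightarrow> 'a \<Rightarrow> 'a" (infixr "*\<^sub>C" 75)
    and cinner :: "'a \<Rightarrow> 'a \<Rightarrow> complex"
  assumes scaleC_add_right: "c *\<^sub>C (x + y) = c *\<^sub>C x + c *\<^sub>C y"
    and scaleC_add_left: "(c + d) *\<^sub>C x = c *\<^sub>C x + d *\<^sub>C x"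
    and scaleC_scaleC: "c *\<^sub>C (d *\<^sub>C x) = (c * d) *\<^sub>C x"
    and scaleR_scaleC: "r *\<^sub>R x = complex_of_real r *\<^sub>C x"
    and cinner_commute: "cinner x y = cnj (cinner y x)"
    and cinner_add_right: "cinner x (y + z) = cinner x y + cinner x z"
    and cinner_scaleC_right: "cinner x (c *\<^sub>C y) = c * cinner x y"
    and inner_eq_Re_cinner: "inner x y = Re (cinner x y)"

lemma scaleC_one [simp]: "1 *\<^sub>C x = (x :: 'a :: complex_hilbert)"
  by (metis of_real_1 scaleR_one scaleR_scaleC)

lemma scaleC_zero_right [simp]: "c *\<^sub>C 0 = (0 :: 'a :: complex_hilbert)"
  using scaleC_add_right[of c 0 0] by simp

lemma cinner_self: "cinner x x = complex_of_real ((norm x)\<^sup>2)" for x :: "'a :: complex_hilbert"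
proof (rule complex_eqI)
  show "Re (cinner x x) = Re (complex_of_real ((norm x)\<^sup>2))"
    by (simp add: inner_eq_Re_cinner[symmetric] power2_norm_eq_inner)
  have "Im (cinner x x) = - Im (cinner x x)"
    by (metis cinner_commute cnj.sel(2))
  then show "Im (cinner x x) = Im (complex_of_real ((norm x)\<^sup>2))" by simp
qed

lemma norm_scaleC [simp]: "norm (c *\<^sub>C x) = cmod c * norm x" for x :: "'a :: complex_hilbert"
proof -
  have "cinner (c *\<^sub>C x) (c *\<^sub>C x) = c * (cnj c * cinner x x)"
    by (metis cinner_commute cinner_scaleC_right complex_cnj_mult)
  then have "complex_of_real ((norm (c *\<^sub>C x))\<^sup>2) = (c * cnj c) * complex_of_real ((norm x)\<^sup>2)"
    unfolding cinner_self mult.assoc .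
  also have "\<dots> = complex_of_real ((cmod c * norm x)\<^sup>2)"
    unfolding complex_norm_square[symmetric] power_mult_distrib by simp
  finally have "complex_of_real ((norm (c *\<^sub>C x))\<^sup>2) = complex_of_real ((cmod c * norm x)\<^sup>2)" .
  then have "(norm (c *\<^sub>C x))\<^sup>2 = (cmod c * norm x)\<^sup>2"
    using of_real_eq_iff by blast
  then show ?thesis by simp
qed

lemma norm_cinner_le: "cmod (cinner x y) \<le> norm x * norm y" for x y :: "'a :: complex_hilbert"
proof (cases "cinner x y = 0")
  case False
  define c where "c = cnj (cinner x y) / complex_of_real (cmod (cinner x y))"
  have c: "cmod c = 1" using False by (simp add: c_def norm_divide)
  have "c * cinner x y = complex_of_real (cmod (cinner x y))"
    using False complex_norm_square[of "cinner x y"]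
    by (simp add: c_def power2_eq_square mult.commute nonzero_divide_eq_eq)
  then have "cmod (cinner x y) = inner x (c *\<^sub>C y)"
    by (simp add: inner_eq_Re_cinner cinner_scaleC_right)
  also have "\<dots> \<le> norm x * norm (c *\<^sub>C y)" by (rule norm_cauchy_schwarz)
  finally show ?thesis by (simp add: c)
qed simp

text \<open>The Hilbert space direct sum is the product type; its norm is the library's \<open>\<ell>\<^sup>2\<close> norm.\<close>

instantiation prod :: (complex_hilbert, complex_hilbert) complex_hilbert
begin

definition "c *\<^sub>C x = (c *\<^sub>C fst x, c *\<^sub>C snd x)"
definition "cinner x y = cinner (fst x) (fst y) + cinner (snd x) (snd y)"

instance
proof
  fix x y z :: "'a \<times> 'b" and c d :: complex and r :: real
  show "c *\<^sub>C (x + y) = c *\<^sub>C x + c *\<^sub>C y" "(c + d) *\<^sub>C x = c *\<^sub>C x + d *\<^sub>C x"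
    "c *\<^sub>C d *\<^sub>C x = (c * d) *\<^sub>C x" "r *\<^sub>R x = complex_of_real r *\<^sub>C x"
    by (simp_all add: scaleC_prod_def scaleC_add_right scaleC_add_left scaleC_scaleC
        scaleR_scaleC scaleR_prod_def)
  show "cinner x y = cnj (cinner y x)"
    unfolding cinner_prod_def complex_cnj_add by (intro arg_cong2[where f = "(+)"] cinner_commute)
  show "cinner x (y + z) = cinner x y + cinner x z"
    by (simp add: cinner_prod_def cinner_add_right)
  show "cinner x (c *\<^sub>C y) = c * cinner x y"
    by (simp add: cinner_prod_def scaleC_prod_def cinner_scaleC_right distrib_left)
  show "inner x y = Re (cinner x y)"
    by (simp add: cinner_prod_def inner_prod_def inner_eq_Re_cinner)
qed

end

section \<open>Operators and subspaces\<close>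

definition bounded_clinear :: "('a :: complex_hilbert \<Rightarrow> 'b :: complex_hilbert) \<Rightarrow> bool" where
  "bounded_clinear T \<longleftrightarrow> bounded_linear T \<and> (\<forall>c x. T (c *\<^sub>C x) = c *\<^sub>C T x)"

definition isometry :: "('a :: complex_hilbert \<Rightarrow> 'b :: complex_hilbert) \<Rightarrow> bool" where
  "isometry T \<longleftrightarrow> bounded_clinear T \<and> (\<forall>x. norm (T x) = norm x)"

definition unitary :: "('a :: complex_hilbert \<Rightarrow> 'b :: complex_hilbert) \<Rightarrow> bool" where
  "unitary T \<longleftrightarrow> isometry T \<and> surj T"

definition ker :: "('a \<Rightarrow> 'b :: zero) \<Rightarrow> 'a set" where
  "ker T = {x. T x = 0}"

definition ortho_compl :: "'a :: complex_hilbert set \<Rightarrow> 'a set" where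
  "ortho_compl S = {x. \<forall>y\<in>S. cinner y x = 0}"

text \<open>Orthogonal projection onto \<open>S\<close>; meaningful when \<open>S\<close> is a closed complex subspace.\<close>

definition projection :: "'a :: complex_hilbert set \<Rightarrow> 'a \<Rightarrow> 'a" where
  "projection S x = (THE y. y \<in> S \<and> x - y \<in> ortho_compl S)"

lemma module_scaleC: "module ((*\<^sub>C) :: complex \<Rightarrow> 'a :: complex_hilbert \<Rightarrow> 'a)"
  by unfold_locales (simp_all add: scaleC_add_right scaleC_add_left scaleC_scaleC)

definition cspan :: "'a :: complex_hilbert set \<Rightarrow> 'a set" where
  "cspan = module.span (*\<^sub>C)"

section \<open>The full Fock space\<close>

text \<open>
  \<open>('d, 'a) fock\<close> is \<open>\<H>\<^sup>2\<^sub>d \<otimes> \<A>\<close>, where \<open>d = CARD('d)\<close> and \<open>\<A>\<close> is the Hilbert space \<open>'a\<close>: the formal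
  power series \<open>\<Sum>\<^sub>w w \<otimes> a\<^sub>w\<close> over the words \<open>w\<close> in the alphabet \<open>'d\<close> with square-summable
  coefficients \<open>a\<^sub>w\<close> in \<open>\<A>\<close>.
\<close>

typedef (overloaded) ('d, 'a) fock =
  "{a :: 'd list \<Rightarrow> 'a :: complex_hilbert. (\<lambda>w. (norm (a w))\<^sup>2) summable_on UNIV}"
  morphisms coeff Abs_fock
  by (rule exI[of _ "\<lambda>_. 0"]) simp

setup_lifting type_definition_fock

lemma summable_coeff: "(\<lambda>w. (norm (coeff a w))\<^sup>2) summable_on UNIV"
  using coeff[of a] by simp

lemma square_summable_add:
  fixes a b :: "'i \<Rightarrow> 'a :: real_normed_vector"
  assumes "(\<lambda>w. (norm (a w))\<^sup>2) summable_on S" "(\<lambda>w. (norm (b w))\<^sup>2) summable_on S"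
  shows "(\<lambda>w. (norm (a w + b w))\<^sup>2) summable_on S"
proof (rule summable_on_comparison_test)
  show "(\<lambda>w. 2 * (norm (a w))\<^sup>2 + 2 * (norm (b w))\<^sup>2) summable_on S"
    by (intro summable_on_add summable_on_cmult_right assms)
  fix w
  have "(norm (a w + b w))\<^sup>2 \<le> (norm (a w) + norm (b w))\<^sup>2"
    by (intro power_mono norm_triangle_ineq norm_ge_zero)
  also have "\<dots> \<le> 2 * (norm (a w))\<^sup>2 + 2 * (norm (b w))\<^sup>2"
    using sum_squares_bound[of "norm (a w)" "norm (b w)"] by (simp add: power2_sum)
  finally show "(norm (a w + b w))\<^sup>2 \<le> 2 * (norm (a w))\<^sup>2 + 2 * (norm (b w))\<^sup>2" .
qed simp

lemma abs_summable_coeff_mult: "(\<lambda>w. norm (coeff a w) * norm (coeff b w)) summable_on UNIV"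
proof (rule summable_on_comparison_test)
  show "(\<lambda>w. (norm (coeff a w))\<^sup>2 + (norm (coeff b w))\<^sup>2) summable_on UNIV"
    by (intro summable_on_add summable_coeff)
  fix w
  show "norm (coeff a w) * norm (coeff b w) \<le> (norm (coeff a w))\<^sup>2 + (norm (coeff b w))\<^sup>2"
    using sum_squares_bound[of "norm (coeff a w)" "norm (coeff b w)"]
      mult_nonneg_nonneg[OF norm_ge_zero norm_ge_zero, of "coeff a w" "coeff b w"]
    unfolding mult.assoc by linarith
qed simp

lemma summable_cinner_coeff: "(\<lambda>w. cinner (coeff a w) (coeff b w)) summable_on UNIV"
proof (rule abs_summable_summable, rule summable_on_comparison_test)
  show "(\<lambda>w. norm (coeff a w) * norm (coeff b w)) summable_on UNIV"
    by (rule abs_summable_coeff_mult)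
qed (auto intro: norm_cinner_le)

lemma summable_inner_coeff: "(\<lambda>w. inner (coeff a w) (coeff b w)) summable_on UNIV"
  unfolding inner_eq_Re_cinner by (rule summable_on_Re[OF summable_cinner_coeff])

instantiation fock :: (type, complex_hilbert) real_normed_vector
begin

lift_definition zero_fock :: "('a, 'b) fock" is "\<lambda>_. 0" by simp
lift_definition plus_fock :: "('a, 'b) fock \<Rightarrow> ('a, 'b) fock \<Rightarrow> ('a, 'b) fock"
  is "\<lambda>a b w. a w + b w" by (rule square_summable_add)
lift_definition uminus_fock :: "('a, 'b) fock \<Rightarrow> ('a, 'b) fock" is "\<lambda>a w. - a w" by simp
lift_definition minus_fock :: "('a, 'b) fock \<Rightarrow> ('a, 'b) fock \<Rightarrow> ('a, 'b) fock"
  is "\<lambda>a b w. a w - b w"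
  subgoal for a b using square_summable_add[of a UNIV "\<lambda>w. - b w"] by simp
  done
lift_definition scaleR_fock :: "real \<Rightarrow> ('a, 'b) fock \<Rightarrow> ('a, 'b) fock"
  is "\<lambda>r a w. r *\<^sub>R a w" by (simp add: power_mult_distrib summable_on_cmult_right)

definition norm_fock :: "('a, 'b) fock \<Rightarrow> real" where
  "norm_fock a = sqrt (\<Sum>\<^sub>\<infinity>w. (norm (coeff a w))\<^sup>2)"
definition sgn_fock :: "('a, 'b) fock \<Rightarrow> ('a, 'b) fock" where
  "sgn_fock a = inverse (norm a) *\<^sub>R a"
definition dist_fock :: "('a, 'b) fock \<Rightarrow> ('a, 'b) fock \<Rightarrow> real" where
  "dist_fock a b = norm (a - b)"
definition uniformity_fock :: "(('a, 'b) fock \<times> ('a, 'b) fock) filter" where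
  "uniformity_fock = (INF e\<in>{0<..}. principal {(x :: ('a, 'b) fock, y). dist x y < e})"
definition open_fock :: "('a, 'b) fock set \<Rightarrow> bool" where
  "open_fock U = (\<forall>x\<in>U. \<forall>\<^sub>F (x', y) in uniformity. x' = x \<longrightarrow> y \<in> U)"

instance
proof
  fix a b c :: "('a, 'b) fock" and r s :: real and U :: "('a, 'b) fock set"
  show "a + b + c = a + (b + c)" "a + b = b + a" "0 + a = a" "- a + a = 0" "a - b = a + - b"
    "r *\<^sub>R (a + b) = r *\<^sub>R a + r *\<^sub>R b" "(r + s) *\<^sub>R a = r *\<^sub>R a + s *\<^sub>R a"
    "r *\<^sub>R s *\<^sub>R a = (r * s) *\<^sub>R a" "1 *\<^sub>R a = a"
    by (transfer; simp add: fun_eq_iff algebra_simps)+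
  show "dist a b = norm (a - b)" by (rule dist_fock_def)
  show "sgn a = inverse (norm a) *\<^sub>R a" by (rule sgn_fock_def)
  show "uniformity = (INF e\<in>{0<..}. principal {(x :: ('a, 'b) fock, y). dist x y < e})"
    by (rule uniformity_fock_def)
  show "open U = (\<forall>x\<in>U. \<forall>\<^sub>F (x', y) in uniformity. x' = x \<longrightarrow> y \<in> U)"
    by (rule open_fock_def)
  have nsq: "(norm x)\<^sup>2 = (\<Sum>\<^sub>\<infinity>w. (norm (coeff x w))\<^sup>2)" and n0: "0 \<le> norm x"
    for x :: "('a, 'b) fock"
    by (simp_all add: norm_fock_def infsum_nonneg)
  have L2: "L2_set (\<lambda>w. norm (coeff x w)) A \<le> norm x" if "finite A" for A and x :: "('a, 'b) fock"
    unfolding L2_set_def norm_fock_def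
    using finite_sum_le_infsum[OF summable_coeff[of x] that] by simp
  show "norm (r *\<^sub>R a) = \<bar>r\<bar> * norm a"
    by (simp add: norm_fock_def scaleR_fock.rep_eq power_mult_distrib infsum_cmult_right'
        real_sqrt_mult)
  show "norm a = 0 \<longleftrightarrow> a = 0"
  proof
    assume "norm a = 0"
    then have "(norm (coeff a w))\<^sup>2 = 0" for w
      using nonneg_infsum_le_0D[OF _ summable_coeff[of a], of w] nsq[of a] by simp
    then show "a = 0" by (simp add: coeff_inject[symmetric] zero_fock.rep_eq fun_eq_iff)
  qed (simp add: norm_fock_def zero_fock.rep_eq)
  have "(norm (a + b))\<^sup>2 \<le> (norm a + norm b)\<^sup>2"
    unfolding nsq[of "a + b"]
  proof (rule infsum_le_finite_sums[OF summable_coeff])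
    fix A :: "'a list set" assume A: "finite A"
    have "L2_set (\<lambda>w. norm (coeff (a + b) w)) A
        \<le> L2_set (\<lambda>w. norm (coeff a w) + norm (coeff b w)) A"
      by (intro L2_set_mono) (auto simp: plus_fock.rep_eq norm_triangle_ineq)
    also have "\<dots> \<le> norm a + norm b"
      using L2_set_triangle_ineq[of "\<lambda>w. norm (coeff a w)" "\<lambda>w. norm (coeff b w)" A]
        L2[OF A, of a] L2[OF A, of b] by linarith
    finally show "(\<Sum>w\<in>A. (norm (coeff (a + b) w))\<^sup>2) \<le> (norm a + norm b)\<^sup>2"
      unfolding L2_set_def by (rule sqrt_le_D)
  qed
  then show "norm (a + b) \<le> norm a + norm b"
    by (rule power2_le_imp_le) (simp add: n0)
qed

end

lemma norm_fock_squared: "(norm a)\<^sup>2 = (\<Sum>\<^sub>\<infinity>w. (norm (coeff a w))\<^sup>2)"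
  by (simp add: norm_fock_def infsum_nonneg)

instantiation fock :: (type, complex_hilbert) real_inner
begin

definition inner_fock :: "('a, 'b) fock \<Rightarrow> ('a, 'b) fock \<Rightarrow> real" where
  "inner a b = (\<Sum>\<^sub>\<infinity>w. inner (coeff a w) (coeff b w))"

instance
proof
  fix a b c :: "('a, 'b) fock" and r :: real
  have self: "inner x x = (norm x)\<^sup>2" for x :: "('a, 'b) fock"
    by (simp add: inner_fock_def norm_fock_squared power2_norm_eq_inner)
  show "inner a b = inner b a" by (simp add: inner_fock_def inner_commute)
  show "inner (a + b) c = inner a c + inner b c"
    by (simp add: inner_fock_def plus_fock.rep_eq inner_add_left infsum_add summable_inner_coeff)
  show "inner (r *\<^sub>R a) b = r * inner a b"
    by (simp add: inner_fock_def scaleR_fock.rep_eq infsum_cmult_right')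
  show "0 \<le> inner a a" "inner a a = 0 \<longleftrightarrow> a = 0" "norm a = sqrt (inner a a)"
    by (simp_all add: self)
qed

end

lemma sum_norm_coeff_le: "finite A \<Longrightarrow> (\<Sum>w\<in>A. (norm (coeff a w))\<^sup>2) \<le> (norm a)\<^sup>2"
  unfolding norm_fock_squared by (rule finite_sum_le_infsum[OF summable_coeff]) auto

lemma norm_coeff_le: "norm (coeff a w) \<le> norm a"
  using sum_norm_coeff_le[of "{w}" a] by (simp add: power2_le_iff_abs_le)

instance fock :: (type, complex_hilbert) complete_space
proof
  fix X :: "nat \<Rightarrow> ('a, 'b) fock"
  assume X: "Cauchy X"
  have "Cauchy (\<lambda>n. coeff (X n) w)" for w
  proof (rule CauchyI)
    fix e :: real assume "e > 0"
    then obtain N where N: "\<And>m n. m \<ge> N \<Longrightarrow> n \<ge> N \<Longrightarrow> norm (X m - X n) < e"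
      using CauchyD[OF X] by blast
    show "\<exists>N. \<forall>m\<ge>N. \<forall>n\<ge>N. norm (coeff (X m) w - coeff (X n) w) < e"
      using N norm_coeff_le[of "X _ - X _" w]
      by (intro exI[of _ N]) (metis le_less_trans minus_fock.rep_eq)
  qed
  then have "\<exists>l. (\<lambda>n. coeff (X n) w) \<longlonglongrightarrow> l" for w
    using Cauchy_convergent convergent_def by blast
  then obtain l where l: "\<And>w. (\<lambda>n. coeff (X n) w) \<longlonglongrightarrow> l w" by metis
  have bound: "(\<Sum>w\<in>A. (norm (coeff (X m) w - l w))\<^sup>2) \<le> e\<^sup>2"
    if N: "\<forall>m\<ge>N. \<forall>n\<ge>N. norm (X m - X n) < e" and m: "m \<ge> N" and A: "finite A"
    for N m e and A :: "'a list set"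
  proof (rule tendsto_upperbound)
    show "(\<lambda>n. \<Sum>w\<in>A. (norm (coeff (X m) w - coeff (X n) w))\<^sup>2)
        \<longlonglongrightarrow> (\<Sum>w\<in>A. (norm (coeff (X m) w - l w))\<^sup>2)"
      by (intro tendsto_intros l)
    show "\<forall>\<^sub>F n in sequentially. (\<Sum>w\<in>A. (norm (coeff (X m) w - coeff (X n) w))\<^sup>2) \<le> e\<^sup>2"
      unfolding eventually_sequentially
    proof (intro exI[of _ N] allI impI)
      fix n assume "n \<ge> N"
      have "(\<Sum>w\<in>A. (norm (coeff (X m) w - coeff (X n) w))\<^sup>2) \<le> (norm (X m - X n))\<^sup>2"
        using sum_norm_coeff_le[OF A, of "X m - X n"] by (simp add: minus_fock.rep_eq)
      also have "\<dots> \<le> e\<^sup>2" using N m \<open>n \<ge> N\<close> by (intro power_mono) (auto intro: less_imp_le)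
      finally show "(\<Sum>w\<in>A. (norm (coeff (X m) w - coeff (X n) w))\<^sup>2) \<le> e\<^sup>2" .
    qed
  qed simp
  have sm: "(\<lambda>w. (norm (coeff (X m) w - l w))\<^sup>2) summable_on UNIV"
    if N: "\<forall>m\<ge>N. \<forall>n\<ge>N. norm (X m - X n) < e" and m: "m \<ge> N" for N m e
    by (rule nonneg_bounded_partial_sums_imp_summable_on[where C = "e\<^sup>2"])
      (auto intro: eventually_finite_subsets_at_top_weakI bound[OF N m])
  obtain N1 where N1: "\<forall>m\<ge>N1. \<forall>n\<ge>N1. norm (X m - X n) < 1"
    using CauchyD[OF X, of 1] by auto
  have "(\<lambda>w. (norm (coeff (X N1) w + - (coeff (X N1) w - l w)))\<^sup>2) summable_on UNIV"
    by (rule square_summable_add[OF summable_coeff])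
      (subst norm_minus_cancel, rule sm[OF N1 order_refl])
  then have "(\<lambda>w. (norm (l w))\<^sup>2) summable_on UNIV" by simp
  then have cL: "coeff (Abs_fock l) = l" by (simp add: Abs_fock_inverse)
  have "X \<longlonglongrightarrow> Abs_fock l"
  proof (rule LIMSEQ_I)
    fix r :: real assume "r > 0"
    then obtain N where N: "\<forall>m\<ge>N. \<forall>n\<ge>N. norm (X m - X n) < r / 2"
      using CauchyD[OF X, of "r / 2"] by auto
    have "norm (X m - Abs_fock l) < r" if "m \<ge> N" for m
    proof -
      have "(norm (X m - Abs_fock l))\<^sup>2 \<le> (r / 2)\<^sup>2"
        unfolding norm_fock_squared minus_fock.rep_eq cL
        by (rule infsum_le_finite_sums[OF sm[OF N that]]) (rule bound[OF N that])
      then have "norm (X m - Abs_fock l) \<le> r / 2"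
        using \<open>r > 0\<close> power2_le_imp_le[of "norm (X m - Abs_fock l)" "r / 2"] by simp
      then show ?thesis using \<open>r > 0\<close> by simp
    qed
    then show "\<exists>N. \<forall>n\<ge>N. norm (X n - Abs_fock l) < r" by blast
  qed
  then show "convergent X" by (auto simp: convergent_def)
qed

instantiation fock :: (type, complex_hilbert) complex_hilbert
begin

lift_definition scaleC_fock :: "complex \<Rightarrow> ('a, 'b) fock \<Rightarrow> ('a, 'b) fock"
  is "\<lambda>c a w. c *\<^sub>C a w" by (simp add: power_mult_distrib summable_on_cmult_right)

definition cinner_fock :: "('a, 'b) fock \<Rightarrow> ('a, 'b) fock \<Rightarrow> complex" where
  "cinner a b = (\<Sum>\<^sub>\<infinity>w. cinner (coeff a w) (coeff b w))"

instance
proof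
  fix a b e :: "('a, 'b) fock" and c d :: complex and r :: real
  show "c *\<^sub>C (a + b) = c *\<^sub>C a + c *\<^sub>C b" by transfer (simp add: scaleC_add_right)
  show "(c + d) *\<^sub>C a = c *\<^sub>C a + d *\<^sub>C a" by transfer (simp add: scaleC_add_left)
  show "c *\<^sub>C d *\<^sub>C a = (c * d) *\<^sub>C a" by transfer (simp add: scaleC_scaleC)
  show "r *\<^sub>R a = complex_of_real r *\<^sub>C a" by transfer (simp add: scaleR_scaleC)
  show "cinner a b = cnj (cinner b a)"
  proof -
    have "cinner a b = (\<Sum>\<^sub>\<infinity>w. cnj (cinner (coeff b w) (coeff a w)))"
      unfolding cinner_fock_def by (intro infsum_cong cinner_commute)
    then show ?thesis by (simp add: cinner_fock_def)
  qed
  show "cinner a (b + e) = cinner a b + cinner a e"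
    by (simp add: cinner_fock_def plus_fock.rep_eq cinner_add_right infsum_add
        summable_cinner_coeff)
  show "cinner a (c *\<^sub>C b) = c * cinner a b"
    by (simp add: cinner_fock_def scaleC_fock.rep_eq cinner_scaleC_right infsum_cmult_right')
  show "inner a b = Re (cinner a b)"
    by (simp add: cinner_fock_def inner_fock_def inner_eq_Re_cinner
        infsum_Re[OF summable_cinner_coeff])
qed

end

text \<open>\<open>right_mult k\<close> is \<open>R\<^sub>k \<otimes> I\<close>: it sends the word \<open>v\<close> to \<open>v \<^bold>\<cdot> k\<close>.\<close>

lift_definition right_mult :: "'d \<Rightarrow> ('d, 'a :: complex_hilbert) fock \<Rightarrow> ('d, 'a) fock"
  is "\<lambda>k a w. if w \<noteq> [] \<and> last w = k then a (butlast w) else 0"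
proof -
  fix k :: 'd and a :: "'d list \<Rightarrow> 'a"
  assume "(\<lambda>w. (norm (a w))\<^sup>2) summable_on UNIV"
  then have "((\<lambda>w. (norm (a (butlast w)))\<^sup>2) \<circ> (\<lambda>v. v @ [k])) summable_on UNIV"
    by (simp add: o_def)
  then have "(\<lambda>w. (norm (a (butlast w)))\<^sup>2) summable_on range (\<lambda>v. v @ [k])"
    by (subst summable_on_reindex) (auto intro: injI)
  moreover have "w \<in> range (\<lambda>v. v @ [k])" if "w \<noteq> []" "last w = k" for w
    using append_butlast_last_id[OF that(1)] that(2) by (metis rangeI)
  moreover have "(\<lambda>w. (norm (a (butlast w)))\<^sup>2) summable_on range (\<lambda>v. v @ [k])
      \<longleftrightarrow> (\<lambda>w. (norm (if w \<noteq> [] \<and> last w = k then a (butlast w) else 0))\<^sup>2)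
      summable_on UNIV"
    using calculation(2) by (intro summable_on_cong_neutral) auto
  ultimately show "(\<lambda>w. (norm (if w \<noteq> [] \<and> last w = k then a (butlast w) else 0))\<^sup>2)
      summable_on UNIV" by blast
qed

text \<open>
  The identification of \<open>\<H>\<^sup>2\<^sub>d \<otimes> (\<A> \<oplus> \<B>)\<close> with \<open>(\<H>\<^sup>2\<^sub>d \<otimes> \<A>) \<oplus> (\<H>\<^sup>2\<^sub>d \<otimes> \<B>)\<close>, coefficient by coefficient.
\<close>

lemma norm_fst_le_norm: "norm (fst p) \<le> norm p"
  and norm_snd_le_norm: "norm (snd p) \<le> norm p"
  by (metis norm_fst_le prod.collapse, metis norm_snd_le prod.collapse)

lift_definition fock_fst :: "('d, 'a :: complex_hilbert \<times> 'b :: complex_hilbert) fock \<Rightarrow> ('d, 'a) fock"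
  is "\<lambda>a w. fst (a w)"
  by (erule summable_on_comparison_test) (simp_all add: power_mono norm_fst_le_norm)

lift_definition fock_snd :: "('d, 'a :: complex_hilbert \<times> 'b :: complex_hilbert) fock \<Rightarrow> ('d, 'b) fock"
  is "\<lambda>a w. snd (a w)"
  by (erule summable_on_comparison_test) (simp_all add: power_mono norm_snd_le_norm)

lift_definition fock_pair ::
  "('d, 'a :: complex_hilbert) fock \<Rightarrow> ('d, 'b :: complex_hilbert) fock \<Rightarrow> ('d, 'a \<times> 'b) fock"
  is "\<lambda>a b w. (a w, b w)"
  by (simp add: norm_Pair summable_on_add)

section \<open>Left multipliers\<close>

text \<open>
  An operator-valued left multiplier is identified with its multiplication operator \<open>F(L)\<close>.
\<close>

definition left_multiplier ::
  "(('d, 'a :: complex_hilbert) fock \<Rightarrow> ('d, 'b :: complex_hilbert) fock) \<Rightarrow> bool" where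
  "left_multiplier F \<longleftrightarrow>
     bounded_clinear F \<and> (\<forall>k x. F (right_mult k x) = right_mult k (F x))"

definition inner_multiplier ::
  "(('d, 'a :: complex_hilbert) fock \<Rightarrow> ('d, 'b :: complex_hilbert) fock) \<Rightarrow> bool" where
  "inner_multiplier F \<longleftrightarrow> left_multiplier F \<and> isometry F"

text \<open>Block operators: the row \<open>(F, G)\<close>, the column with entries \<open>A\<close> and \<open>B\<close>, and the diagonal.\<close>

definition block_row ::
  "(('d, 'f :: complex_hilbert) fock \<Rightarrow> ('d, 'j :: complex_hilbert) fock) \<Rightarrow>
   (('d, 'g :: complex_hilbert) fock \<Rightarrow> ('d, 'j) fock) \<Rightarrow> ('d, 'f \<times> 'g) fock \<Rightarrow> ('d, 'j) fock" where
  "block_row F G x = F (fock_fst x) + G (fock_snd x)"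

definition block_col ::
  "(('d, 'h :: complex_hilbert) fock \<Rightarrow> ('d, 'a :: complex_hilbert) fock) \<Rightarrow>
   (('d, 'h) fock \<Rightarrow> ('d, 'b :: complex_hilbert) fock) \<Rightarrow> ('d, 'h) fock \<Rightarrow> ('d, 'a \<times> 'b) fock" where
  "block_col A B x = fock_pair (A x) (B x)"

definition block_diag ::
  "(('d, 'f :: complex_hilbert) fock \<Rightarrow> ('d, 'a :: complex_hilbert) fock) \<Rightarrow>
   (('d, 'g :: complex_hilbert) fock \<Rightarrow> ('d, 'b :: complex_hilbert) fock) \<Rightarrow>
   ('d, 'f \<times> 'g) fock \<Rightarrow> ('d, 'a \<times> 'b) fock" where
  "block_diag F G x = fock_pair (F (fock_fst x)) (G (fock_snd x))"

text \<open>
  The range norm of \<open>\<M>\<^sup>L(F)\<close>: all \<open>x\<close> with \<open>F x = h\<close> have the same projection onto \<open>(ker F)\<^sup>\<bottom>\<close>.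
  The value is meaningful only for \<open>h\<close> in the range of \<open>F\<close>.
\<close>

definition range_norm :: "('a :: complex_hilbert \<Rightarrow> 'b :: zero) \<Rightarrow> 'b \<Rightarrow> real" where
  "range_norm F h = (THE r. \<forall>x. F x = h \<longrightarrow> r = norm (projection (ortho_compl (ker F)) x))"

definition meet_space :: "('a \<Rightarrow> 'c) \<Rightarrow> ('b \<Rightarrow> 'c) \<Rightarrow> 'c set" where
  "meet_space F G = range F \<inter> range G"

definition meet_norm ::
  "('a :: complex_hilbert \<Rightarrow> 'c :: zero) \<Rightarrow> ('b :: complex_hilbert \<Rightarrow> 'c) \<Rightarrow> 'c \<Rightarrow> real" where
  "meet_norm F G h = sqrt ((range_norm F h)\<^sup>2 + (range_norm G h)\<^sup>2)"

section \<open>The de Branges--Beurling construction\<close>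

text \<open>
  A Hilbert space \<open>\<M>\<close> that is a linear subspace \<open>M\<close> of some \<open>'c\<close>, but with its own norm \<open>nrm\<close>,
  sits inside a Hilbert space \<open>'m\<close> by a linear map \<open>\<iota>\<close> on \<open>M\<close> that preserves norms, and hence, by
  polarization, inner products. This renders the inclusion of \<open>\<M>\<close> in a larger Hilbert space.
\<close>

definition hilbert_inclusion ::
  "'c :: complex_hilbert set \<Rightarrow> ('c \<Rightarrow> real) \<Rightarrow> ('c \<Rightarrow> 'm :: complex_hilbert) \<Rightarrow> bool" where
  "hilbert_inclusion M nrm \<iota> \<longleftrightarrow>
     (\<forall>x\<in>M. \<forall>y\<in>M. \<iota> (x + y) = \<iota> x + \<iota> y) \<and>
     (\<forall>c. \<forall>x\<in>M. \<iota> (c *\<^sub>C x) = c *\<^sub>C \<iota> x) \<and>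
     (\<forall>x\<in>M. norm (\<iota> x) = nrm x)"

definition row_isometry :: "('d \<Rightarrow> 'm :: complex_hilbert \<Rightarrow> 'm) \<Rightarrow> bool" where
  "row_isometry V \<longleftrightarrow>
     (\<forall>k. isometry (V k)) \<and> (\<forall>j k x y. j \<noteq> k \<longrightarrow> cinner (V j x) (V k y) = 0)"

text \<open>
  For a word \<open>\<alpha> = [i\<^sub>1, \<dots>, i\<^sub>n]\<close>, the term \<open>foldr V \<alpha>\<close> is the product
  \<open>V\<^sup>\<alpha> = V i\<^sub>1 \<circ> \<dots> \<circ> V i\<^sub>n\<close>.
\<close>

definition minimal_row_isometric_dilation ::
  "'c :: complex_hilbert set \<Rightarrow> ('c \<Rightarrow> 'm :: complex_hilbert) \<Rightarrow>
   ('d \<Rightarrow> 'c \<Rightarrow> 'c) \<Rightarrow> ('d \<Rightarrow> 'm \<Rightarrow> 'm) \<Rightarrow> bool" where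
  "minimal_row_isometric_dilation M \<iota> X V \<longleftrightarrow>
     row_isometry V \<and>
     (\<forall>\<alpha>. \<forall>h\<in>M. projection (\<iota> ` M) (foldr V \<alpha> (\<iota> h)) = \<iota> (foldr X \<alpha> h)) \<and>
     closure (cspan {foldr V \<alpha> (\<iota> h) | \<alpha> h. h \<in> M}) = UNIV"

text \<open>
  \<open>is_meet F G \<iota> V U H\<close>: the operator \<open>H = e P\<^sub>\<M> U\<close> is a realization of \<open>F \<and> G\<close>, where \<open>'m\<close> is the
  dilation space, \<open>V\<close> the minimal row isometric dilation of \<open>R \<otimes> I\<close> restricted to \<open>\<M>\<close>, and \<open>U\<close>
  the unitary from \<open>\<H>\<^sup>2\<^sub>d \<otimes> \<H>\<close>. As \<open>\<M>\<close> is embedded by \<open>\<iota>\<close>, the map \<open>e\<close> undoes \<open>\<iota>\<close>.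
\<close>

definition is_meet ::
  "(('d, 'f :: complex_hilbert) fock \<Rightarrow> ('d, 'j :: complex_hilbert) fock) \<Rightarrow>
   (('d, 'g :: complex_hilbert) fock \<Rightarrow> ('d, 'j) fock) \<Rightarrow>
   (('d, 'j) fock \<Rightarrow> 'm :: complex_hilbert) \<Rightarrow> ('d \<Rightarrow> 'm \<Rightarrow> 'm) \<Rightarrow>
   (('d, 'h :: complex_hilbert) fock \<Rightarrow> 'm) \<Rightarrow> (('d, 'h) fock \<Rightarrow> ('d, 'j) fock) \<Rightarrow> bool" where
  "is_meet F G \<iota> V U H \<longleftrightarrow>
     (let M = meet_space F G in
       hilbert_inclusion M (meet_norm F G) \<iota> \<and>
       minimal_row_isometric_dilation M \<iota> right_mult V \<and>
       unitary U \<and> (\<forall>k x. U (right_mult k x) = V k (U x)) \<and>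
       (\<forall>x. H x \<in> M \<and> \<iota> (H x) = projection (\<iota> ` M) (U x)))"

end

theory Submission
  imports Defs
begin

text \<open>
  As \<open>F\<close> and \<open>G\<close> are injective, \<open>h \<mapsto> (F\<^sup>-\<^sup>1 h, - G\<^sup>-\<^sup>1 h)\<close> is an isometry of \<open>\<M>\<close> onto the kernel of
  \<open>F \<or> G\<close>, and it intertwines the right shifts. So \<open>\<M>\<close> is complete and \<open>R \<otimes> I\<close> restricted to it is
  already a row isometry, which therefore is its own minimal dilation: \<open>P\<^sub>\<M>\<close> is the identity, \<open>H\<close>
  is \<open>U\<close> followed by the embedding, and \<open>\<Gamma>\<close> is \<open>U\<close> followed by the isometry above.
\<close>

section \<open>Complex subspaces and bounded complex-linear maps\<close>

abbreviation csubspace :: "'a :: complex_hilbert set \<Rightarrow> bool" where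
  "csubspace \<equiv> module.subspace (*\<^sub>C)"

lemma csubspace_iff:
  "csubspace S \<longleftrightarrow> 0 \<in> S \<and> (\<forall>x\<in>S. \<forall>y\<in>S. x + y \<in> S) \<and> (\<forall>c. \<forall>x\<in>S. c *\<^sub>C x \<in> S)"
  by (rule module.subspace_def[OF module_scaleC])

lemma scaleC_minus_one: "(- 1) *\<^sub>C x = - (x :: 'a :: complex_hilbert)"
  by (metis of_real_1 of_real_minus scaleR_minus1_left scaleR_scaleC)

lemma csubspace_scaleR: "csubspace S \<Longrightarrow> x \<in> S \<Longrightarrow> r *\<^sub>R x \<in> S"
  by (simp add: csubspace_iff scaleR_scaleC)

lemma csubspace_diff: "csubspace S \<Longrightarrow> x \<in> S \<Longrightarrow> y \<in> S \<Longrightarrow> x - y \<in> S"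
  by (rule module.subspace_diff[OF module_scaleC])

lemma bounded_clinearI:
  assumes "\<And>x y. T (x + y) = T x + T y" "\<And>c x. T (c *\<^sub>C x) = c *\<^sub>C T x"
    and "\<And>x. norm (T x) \<le> norm x * B"
  shows "bounded_clinear T"
  unfolding bounded_clinear_def
  using assms by (auto intro!: bounded_linear_intro simp: scaleR_scaleC)

lemma bounded_clinear_imp_bounded_linear: "bounded_clinear T \<Longrightarrow> bounded_linear T"
  by (simp add: bounded_clinear_def)

lemma bounded_clinear_compose:
  "bounded_clinear S \<Longrightarrow> bounded_clinear T \<Longrightarrow> bounded_clinear (\<lambda>x. S (T x))"
  by (auto simp: bounded_clinear_def bounded_linear_compose)

section \<open>Orthogonal projection onto closed subspaces\<close>

text \<open>A complex subspace is closed under multiplication by \<open>\<i>\<close>, and this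
  recovers the imaginary part of \<open>cinner\<close> from real inner products. The projection
  arguments can then work with \<open>inner\<close> alone.\<close>

lemma ortho_compl_inner:
  assumes S: "csubspace S"
  shows "r \<in> ortho_compl S \<longleftrightarrow> (\<forall>z\<in>S. inner r z = 0)"
proof
  assume "r \<in> ortho_compl S"
  then show "\<forall>z\<in>S. inner r z = 0"
    by (metis (mono_tags) inner_commute inner_eq_Re_cinner mem_Collect_eq ortho_compl_def
        zero_complex.sel(1))
next
  assume r: "\<forall>z\<in>S. inner r z = 0"
  have "cinner z r = 0" if z: "z \<in> S" for z
  proof -
    \<comment> \<open>The real part of \<open>cinner r (\<i> *\<^sub>C z)\<close> is minus the
      imaginary part of \<open>cinner r z\<close>.\<close>
    have "\<i> *\<^sub>C z \<in> S" using S z by (simp add: csubspace_iff)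
    then have "Re (cinner r (\<i> *\<^sub>C z)) = 0" "Re (cinner r z) = 0"
      using r z by (simp_all flip: inner_eq_Re_cinner)
    then have "cinner r z = 0" by (simp add: cinner_scaleC_right complex_eq_iff)
    then show ?thesis by (metis cinner_commute complex_cnj_zero)
  qed
  then show "r \<in> ortho_compl S" by (simp add: ortho_compl_def)
qed

text \<open>A minimising sequence in \<open>S\<close> is Cauchy by the parallelogram law; its limit
  exists by completeness and stays in \<open>S\<close> by closedness.\<close>

lemma closest_point_subspace_exists:
  fixes S :: "'a :: complex_hilbert set"
  assumes S: "csubspace S" "closed S"
  obtains y where "y \<in> S" "\<And>z. z \<in> S \<Longrightarrow> norm (x - y) \<le> norm (x - z)"
proof -
  have "S \<noteq> {}" using S(1) by (auto simp: csubspace_iff)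
  define d where "d = infdist x S"
  have d0: "0 \<le> d" by (simp add: d_def infdist_nonneg)
  have dle: "d \<le> norm (x - z)" if "z \<in> S" for z
    using infdist_le[OF that, of x] by (simp add: d_def dist_norm)
  \<comment> \<open>The slack is put on the squared distance because the parallelogram law compares
    squared norms.\<close>
  have "\<exists>y\<in>S. (norm (x - y))\<^sup>2 < d\<^sup>2 + 1 / real (Suc n)" for n
  proof -
    have "sqrt (d\<^sup>2 + 1 / real (Suc n)) > d"
      using d0 by (intro real_less_rsqrt) auto
    then have "(INF y\<in>S. dist x y) < sqrt (d\<^sup>2 + 1 / real (Suc n))"
      using \<open>S \<noteq> {}\<close> by (simp add: d_def infdist_def)
    then obtain y where y: "y \<in> S" "norm (x - y) < sqrt (d\<^sup>2 + 1 / real (Suc n))"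
      using \<open>S \<noteq> {}\<close> by (subst (asm) cINF_less_iff) (auto simp: dist_norm intro!: bdd_belowI2[of _ 0])
    have "(norm (x - y))\<^sup>2 < (sqrt (d\<^sup>2 + 1 / real (Suc n)))\<^sup>2"
      using y(2) by (intro power_strict_mono) auto
    then show ?thesis using y(1) by auto
  qed
  then obtain y where yS: "\<And>n. y n \<in> S" and y: "\<And>n. (norm (x - y n))\<^sup>2 < d\<^sup>2 + 1 / real (Suc n)"
    by metis
  have bound: "(norm (y m - y n))\<^sup>2 \<le> 2 / real (Suc m) + 2 / real (Suc n)" for m n
  proof -
    \<comment> \<open>The midpoint of two near-minimisers lies in \<open>S\<close>, so it cannot be
      closer to \<open>x\<close> than \<open>d\<close>.\<close>
    have "(1/2) *\<^sub>R (y m + y n) \<in> S"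
      using S(1) yS by (intro csubspace_scaleR) (auto simp: csubspace_iff)
    then have "d\<^sup>2 \<le> (norm (x - (1/2) *\<^sub>R (y m + y n)))\<^sup>2"
      using dle d0 by (intro power_mono) auto
    \<comment> \<open>This is the parallelogram law for \<open>x - y m\<close> and
      \<open>x - y n\<close>.\<close>
    moreover have "(norm (y m - y n))\<^sup>2 + 4 * (norm (x - (1/2) *\<^sub>R (y m + y n)))\<^sup>2
        = 2 * (norm (x - y m))\<^sup>2 + 2 * (norm (x - y n))\<^sup>2"
      by (simp add: power2_norm_eq_inner inner_simps inner_commute algebra_simps)
    ultimately show ?thesis using y[of m] y[of n] by simp
  qed
  have "Cauchy y"
  proof (rule CauchyI)
    fix e :: real assume e: "e > 0"
    \<comment> \<open>For \<open>m\<close> and \<open>n\<close> beyond \<open>N\<close> the two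
      terms of \<open>bound\<close> add up to at most \<open>4 / real (Suc N)\<close>, hence the
      quarter.\<close>
    then obtain N where N: "inverse (real (Suc N)) < e\<^sup>2 / 4"
      using reals_Archimedean[of "e\<^sup>2 / 4"] by auto
    have "norm (y m - y n) < e" if "m \<ge> N" "n \<ge> N" for m n
    proof -
      have "1 / real (Suc m) \<le> 1 / real (Suc N)" "1 / real (Suc n) \<le> 1 / real (Suc N)"
        using that by (simp_all add: frac_le)
      then have "(norm (y m - y n))\<^sup>2 < e\<^sup>2"
        using bound[of m n] N by (simp add: inverse_eq_divide)
      then show ?thesis using e by (simp add: power2_less_imp_less)
    qed
    then show "\<exists>N. \<forall>m\<ge>N. \<forall>n\<ge>N. norm (y m - y n) < e" by blast
  qed
  then obtain l where l: "y \<longlonglongrightarrow> l" using Cauchy_convergent convergent_def by blast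
  have "l \<in> S" using closed_sequentially[OF S(2)] yS l by blast
  have "(\<lambda>n. (norm (x - y n))\<^sup>2) \<longlonglongrightarrow> (norm (x - l))\<^sup>2"
    by (intro tendsto_intros l)
  moreover have "(\<lambda>n. d\<^sup>2 + 1 / real (Suc n)) \<longlonglongrightarrow> d\<^sup>2"
    using tendsto_add[OF tendsto_const[of "d\<^sup>2"] LIMSEQ_inverse_real_of_nat]
    by (simp add: inverse_eq_divide)
  ultimately have "(norm (x - l))\<^sup>2 \<le> d\<^sup>2"
    using y by (intro LIMSEQ_le) (auto intro!: exI[of _ 0] less_imp_le)
  then have "norm (x - l) \<le> d" using d0 by (rule power2_le_imp_le)
  then show thesis using that[OF \<open>l \<in> S\<close>] dle by force
qed

text \<open>The residual at a closest point is orthogonal to \<open>S\<close>: otherwise a step from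
  \<open>y\<close> along some \<open>z\<close> in \<open>S\<close> would shorten the distance to
  \<open>x\<close>.\<close>

lemma orthogonal_decomposition_exists:
  assumes S: "csubspace S" "closed S"
  obtains y where "y \<in> S" "x - y \<in> ortho_compl S"
proof -
  obtain y where y: "y \<in> S" and le: "\<And>z. z \<in> S \<Longrightarrow> norm (x - y) \<le> norm (x - z)"
    using closest_point_subspace_exists[OF S] by blast
  have "inner (x - y) z = 0" if z: "z \<in> S" for z
  proof (cases "z = 0")
    case False
    \<comment> \<open>This \<open>t\<close> minimises the squared norm of
      \<open>x - y - t *\<^sub>R z\<close>; it lowers the squared norm by exactly
      \<open>t * inner (x - y) z\<close>.\<close>
    define t where "t = inner (x - y) z / (norm z)\<^sup>2"
    have "y + t *\<^sub>R z \<in> S" using S(1) y csubspace_scaleR[OF S(1) z] by (simp add: csubspace_iff)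
    then have "(norm (x - y))\<^sup>2 \<le> (norm (x - y - t *\<^sub>R z))\<^sup>2"
      using le by (intro power_mono) (auto simp: diff_diff_eq)
    also have "\<dots> = (norm (x - y))\<^sup>2 - 2 * t * inner (x - y) z + t\<^sup>2 * (norm z)\<^sup>2"
      using dot_norm_neg[of "x - y" "t *\<^sub>R z"] by (simp add: power_mult_distrib)
    also have "t\<^sup>2 * (norm z)\<^sup>2 = t * inner (x - y) z"
      using False by (simp add: t_def power2_eq_square)
    finally have "t * inner (x - y) z \<le> 0" by simp
    moreover have "t * inner (x - y) z = (inner (x - y) z)\<^sup>2 / (norm z)\<^sup>2"
      by (simp add: t_def power2_eq_square)
    ultimately show ?thesis
      using False by (simp add: divide_le_0_iff)
  qed simp
  then show thesis using that y ortho_compl_inner[OF S(1)] by blast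
qed

text \<open>The definite description in \<open>projection\<close> needs uniqueness as well as
  existence: the difference of two candidates lies in \<open>S\<close> and is orthogonal to
  \<open>S\<close>, hence to itself.\<close>

lemma
  assumes S: "csubspace S" "closed S"
  shows projection_in: "projection S x \<in> S"
    and diff_projection_in: "x - projection S x \<in> ortho_compl S"
proof -
  have "\<exists>!y. y \<in> S \<and> x - y \<in> ortho_compl S"
  proof (rule ex_ex1I)
    show "\<exists>y. y \<in> S \<and> x - y \<in> ortho_compl S"
      using orthogonal_decomposition_exists[OF S] by blast
  next
    fix y y' assume y: "y \<in> S \<and> x - y \<in> ortho_compl S" and y': "y' \<in> S \<and> x - y' \<in> ortho_compl S"
    then have "y - y' \<in> S" using csubspace_diff[OF S(1)] by blast
    then have "inner (x - y) (y - y') = 0" "inner (x - y') (y - y') = 0"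
      using y y' ortho_compl_inner[OF S(1)] by blast+
    then have "inner (y - y') (y - y') = 0" by (simp add: inner_diff)
    then show "y = y'" by simp
  qed
  from theI'[OF this] show "projection S x \<in> S" "x - projection S x \<in> ortho_compl S"
    by (simp_all add: projection_def)
qed

lemma projection_fixed:
  assumes "csubspace S" "closed S" "x \<in> S"
  shows "projection S x = x"
proof -
  have "x - projection S x \<in> S"
    using assms by (intro csubspace_diff projection_in)
  then have "inner (x - projection S x) (x - projection S x) = 0"
    using diff_projection_in[OF assms(1,2)] ortho_compl_inner[OF assms(1)] by blast
  then show ?thesis by simp
qed

text \<open>By Pythagoras the squared norm of \<open>x\<close> is that of its projection plus that
  of the residual, so equal norms leave no residual.\<close>

lemma projection_eq_self_if_norm_eq:
  assumes S: "csubspace S" "closed S" and n: "norm (projection S x) = norm x"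
  shows "projection S x = x"
proof -
  define p where "p = projection S x"
  have "inner (x - p) p = 0"
    using projection_in[OF S] diff_projection_in[OF S] ortho_compl_inner[OF S(1)]
    unfolding p_def by blast
  then have "(norm x)\<^sup>2 = (norm p)\<^sup>2 + (norm (x - p))\<^sup>2"
    by (simp add: power2_norm_eq_inner inner_diff inner_commute)
  then show ?thesis using n by (simp add: p_def)
qed

section \<open>Range norms and isometric images\<close>

text \<open>The kernel is trivial, so the projection onto its complement is the identity; the
  preimage is unique, so the definite description has just one candidate,
  \<open>norm x\<close>.\<close>

lemma range_norm_inj:
  fixes F :: "'a :: complex_hilbert \<Rightarrow> 'b :: complex_hilbert"
  assumes F: "bounded_clinear F" "inj F"
  shows "range_norm F (F x) = norm x"
proof -
  interpret F: bounded_linear F by (rule bounded_clinear_imp_bounded_linear[OF F(1)])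
  have "ker F = {0}" using inj_eq[OF F(2), of _ 0] by (simp add: ker_def F.zero)
  moreover have "cinner 0 y = 0" for y :: 'a
    using norm_cinner_le[of 0 y] by simp
  ultimately have "ortho_compl (ker F) = UNIV" by (simp add: ortho_compl_def)
  moreover have "projection UNIV y = y" for y :: 'a
    by (intro projection_fixed) (auto simp: csubspace_iff)
  ultimately show ?thesis using F(2) by (auto simp: range_norm_def inj_eq)
qed

text \<open>Preimages in \<open>K\<close> of a Cauchy sequence are again Cauchy, and their limit in
  \<open>K\<close> is mapped to the limit sought.\<close>

lemma complete_isometric_on_image:
  fixes f :: "'a :: metric_space \<Rightarrow> 'b :: metric_space"
  assumes K: "complete K" and f: "\<And>x y. x \<in> K \<Longrightarrow> y \<in> K \<Longrightarrow> dist (f x) (f y) = dist x y"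
  shows "complete (f ` K)"
proof (rule completeI)
  fix u assume u: "\<forall>n. u n \<in> f ` K" "Cauchy u"
  then have "\<forall>n. \<exists>x. x \<in> K \<and> u n = f x" by blast
  then obtain v where v: "\<And>n. v n \<in> K" "\<And>n. u n = f (v n)" by metis
  have "Cauchy v" using u(2) unfolding Cauchy_def v(2) f[OF v(1) v(1)] .
  then obtain l where l: "l \<in> K" "v \<longlonglongrightarrow> l" using K v(1) by (meson completeE)
  have "u \<longlonglongrightarrow> f l"
    using l(2) unfolding lim_sequentially v(2) f[OF v(1) l(1)] .
  then show "\<exists>l\<in>f ` K. u \<longlonglongrightarrow> l" using l(1) by blast
qed

section \<open>Coordinates and right shifts on the Fock space\<close>

lemma
  shows fock_fst_add: "fock_fst (x + y) = fock_fst x + fock_fst y"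
    and fock_snd_add: "fock_snd (x + y) = fock_snd x + fock_snd y"
    and fock_fst_scaleC: "fock_fst (c *\<^sub>C x) = c *\<^sub>C fock_fst x"
    and fock_snd_scaleC: "fock_snd (c *\<^sub>C x) = c *\<^sub>C fock_snd x"
    and fock_fst_pair [simp]: "fock_fst (fock_pair a b) = a"
    and fock_snd_pair [simp]: "fock_snd (fock_pair a b) = b"
    and fock_pair_collapse [simp]: "fock_pair (fock_fst x) (fock_snd x) = x"
  by (transfer; auto simp: scaleC_prod_def fun_eq_iff)+

lemma norm_fock_pair: "(norm (fock_pair a b))\<^sup>2 = (norm a)\<^sup>2 + (norm b)\<^sup>2"
  unfolding norm_fock_squared
  by (simp add: fock_pair.rep_eq norm_Pair infsum_add summable_coeff)

lemma fock_pair_add: "fock_pair (a + a') (b + b') = fock_pair a b + fock_pair a' b'"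
  and fock_pair_scaleC: "fock_pair (c *\<^sub>C a) (c *\<^sub>C b) = c *\<^sub>C fock_pair a b"
  and fock_pair_right_mult:
    "fock_pair (right_mult k a) (right_mult k b) = right_mult k (fock_pair a b)"
  by (transfer; auto simp: scaleC_prod_def fun_eq_iff zero_prod_def)+

lemma
  shows bounded_clinear_fock_fst:
      "bounded_clinear (fock_fst :: ('d, 'a :: complex_hilbert \<times> 'b :: complex_hilbert) fock \<Rightarrow> _)"
    and bounded_clinear_fock_snd: "bounded_clinear (fock_snd :: ('d, 'a \<times> 'b) fock \<Rightarrow> _)"
proof -
  have "norm (fock_fst x) \<le> norm x" "norm (fock_snd x) \<le> norm x"
    for x :: "('d, 'a :: complex_hilbert \<times> 'b :: complex_hilbert) fock"
    using norm_fock_pair[of "fock_fst x" "fock_snd x"]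
    by (simp_all add: power2_le_imp_le)
  then show "bounded_clinear (fock_fst :: ('d, 'a \<times> 'b) fock \<Rightarrow> _)"
    "bounded_clinear (fock_snd :: ('d, 'a \<times> 'b) fock \<Rightarrow> _)"
    by (auto intro!: bounded_clinearI[where B = 1] simp: fock_fst_add fock_snd_add
        fock_fst_scaleC fock_snd_scaleC)
qed

lemma right_mult_minus: "right_mult k (- x) = - right_mult k x"
  by transfer auto

text \<open>The shifted series is supported on words ending in \<open>k\<close>, and appending
  \<open>k\<close> is an injective reindexing that carries the old coefficients to the new
  ones.\<close>

lemma norm_right_mult: "norm (right_mult k x) = norm x"
proof -
  have "(\<Sum>\<^sub>\<infinity>w. (norm (coeff (right_mult k x) w))\<^sup>2)
      = (\<Sum>\<^sub>\<infinity>w\<in>range (\<lambda>v. v @ [k]). (norm (coeff (right_mult k x) w))\<^sup>2)"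
  proof (rule infsum_cong_neutral)
    fix w assume "w \<in> UNIV - range (\<lambda>v. v @ [k])"
    then have "w = [] \<or> last w \<noteq> k" by (metis DiffE append_butlast_last_id rangeI)
    then show "(norm (coeff (right_mult k x) w))\<^sup>2 = 0" by (auto simp: right_mult.rep_eq)
  qed auto
  also have "\<dots> = (\<Sum>\<^sub>\<infinity>v. (norm (coeff (right_mult k x) (v @ [k])))\<^sup>2)"
    by (subst infsum_reindex) (auto intro: injI simp: o_def)
  also have "\<dots> = (\<Sum>\<^sub>\<infinity>v. (norm (coeff x v))\<^sup>2)" by (simp add: right_mult.rep_eq)
  finally show ?thesis by (simp add: norm_fock_def)
qed

section \<open>The meet space and its embedded image\<close>

lemma meet_norm_squared:
  assumes "bounded_clinear F" "inj F" "bounded_clinear G" "inj G" "F a = h" "G b = h"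
  shows "(meet_norm F G h)\<^sup>2 = (norm a)\<^sup>2 + (norm b)\<^sup>2"
  using range_norm_inj[OF assms(1,2), of a] range_norm_inj[OF assms(3,4), of b] assms(5,6)
  by (simp add: meet_norm_def)

lemma csubspace_range:
  assumes T: "bounded_clinear T"
  shows "csubspace (range T)"
proof -
  interpret T: bounded_linear T by (rule bounded_clinear_imp_bounded_linear[OF T])
  have "T x + T y = T (x + y)" "c *\<^sub>C T x = T (c *\<^sub>C x)" for x y c
    using T by (simp_all add: bounded_clinear_def T.add T.zero)
  moreover have "0 \<in> range T" by (metis T.zero rangeI)
  ultimately show ?thesis by (auto simp: csubspace_iff)
qed

lemma csubspace_meet_space:
  assumes "bounded_clinear F" "bounded_clinear G"
  shows "csubspace (meet_space F G)"
  using csubspace_range[OF assms(1)] csubspace_range[OF assms(2)]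
  unfolding meet_space_def by (rule module.subspace_inter[OF module_scaleC])

text \<open>Completeness comes from the row: its kernel is closed by continuity, hence complete, and
  sending \<open>x\<close> to \<open>\<iota> (F (fock_fst x))\<close> maps this kernel isometrically
  onto the embedded meet space.\<close>

lemma closed_image_meet_space:
  fixes F :: "('d, 'f :: complex_hilbert) fock \<Rightarrow> ('d, 'j :: complex_hilbert) fock"
    and G :: "('d, 'g :: complex_hilbert) fock \<Rightarrow> ('d, 'j) fock"
  assumes F: "bounded_clinear F" "inj F" and G: "bounded_clinear G" "inj G"
    and \<iota>: "hilbert_inclusion (meet_space F G) (meet_norm F G) \<iota>"
  shows "closed (\<iota> ` meet_space F G)"
proof -
  let ?M = "meet_space F G" and ?K = "ker (block_row F G)"
  interpret F: bounded_linear F by (rule bounded_clinear_imp_bounded_linear[OF F(1)])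
  interpret G: bounded_linear G by (rule bounded_clinear_imp_bounded_linear[OF G(1)])
  interpret p: bounded_linear "fock_fst :: ('d, 'f \<times> 'g) fock \<Rightarrow> _"
    by (intro bounded_clinear_imp_bounded_linear bounded_clinear_fock_fst)
  interpret q: bounded_linear "fock_snd :: ('d, 'f \<times> 'g) fock \<Rightarrow> _"
    by (intro bounded_clinear_imp_bounded_linear bounded_clinear_fock_snd)
  have "continuous_on UNIV (block_row F G)"
    unfolding block_row_def
    by (intro continuous_intros F.continuous_on G.continuous_on p.continuous_on q.continuous_on)
  then have "closed ?K"
    unfolding ker_def using closed_Collect_eq[OF _ continuous_on_const] by auto
  then have K: "complete ?K" by (simp add: complete_eq_closed)
  \<comment> \<open>Kernel vectors are the pairs (a, -b) with F a = G b, so their first coordinates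
    are mapped by \<open>F\<close> into both ranges.\<close>
  have FG: "F (fock_fst x) = G (- fock_snd x)" if "x \<in> ?K" for x
    using that by (simp add: ker_def block_row_def G.neg eq_neg_iff_add_eq_0)
  have "dist (\<iota> (F (fock_fst x))) (\<iota> (F (fock_fst y))) = dist x y" if "x \<in> ?K" "y \<in> ?K" for x y
  proof -
    have M: "F (fock_fst z) \<in> ?M" if "z \<in> ?K" for z
      unfolding meet_space_def using FG[OF that] by (metis IntI rangeI)
    have "block_row F G (x - y) = block_row F G x - block_row F G y"
      by (simp add: block_row_def p.diff q.diff F.diff G.diff)
    then have xy: "x - y \<in> ?K" using that by (simp add: ker_def)
    \<comment> \<open>Additivity of \<open>\<iota>\<close> is known only on the meet space, so the
      difference is rewritten as a sum of members of that space.\<close>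
    have "\<iota> (F (fock_fst x)) = \<iota> (F (fock_fst (x - y))) + \<iota> (F (fock_fst y))"
      using \<iota> M[OF xy] M[OF that(2)] unfolding hilbert_inclusion_def
      by (metis F.diff p.diff diff_add_cancel)
    then have "dist (\<iota> (F (fock_fst x))) (\<iota> (F (fock_fst y))) = meet_norm F G (F (fock_fst (x - y)))"
      using \<iota> M[OF xy] by (simp add: dist_norm hilbert_inclusion_def)
    \<comment> \<open>The unique preimages are the first coordinate of \<open>x - y\<close> and the
      negated second one; the sign does not affect the norm.\<close>
    moreover have "(meet_norm F G (F (fock_fst (x - y))))\<^sup>2 = (norm (x - y))\<^sup>2"
      using meet_norm_squared[OF F G refl FG[OF xy, symmetric]]
        norm_fock_pair[of "fock_fst (x - y)" "fock_snd (x - y)"] by simp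
    moreover have "0 \<le> meet_norm F G (F (fock_fst (x - y)))" by (simp add: meet_norm_def)
    ultimately show ?thesis by (simp add: dist_norm)
  qed
  from complete_isometric_on_image[OF K this]
  have "closed ((\<lambda>x. \<iota> (F (fock_fst x))) ` ?K)" by (simp add: complete_eq_closed)
  also have "(\<lambda>x. \<iota> (F (fock_fst x))) ` ?K = \<iota> ` ?M"
  proof (intro equalityI image_subsetI)
    fix h assume "h \<in> ?M"
    then obtain a b where ab: "h = F a" "h = G b" unfolding meet_space_def by (metis IntE imageE)
    then have "fock_pair a (- b) \<in> ?K" by (simp add: ker_def block_row_def G.neg)
    then show "\<iota> h \<in> (\<lambda>x. \<iota> (F (fock_fst x))) ` ?K"
      using ab(1) by (force intro: image_eqI)
  next
    fix x assume "x \<in> ?K"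
    then show "\<iota> (F (fock_fst x)) \<in> \<iota> ` ?M"
      unfolding meet_space_def using FG by (metis IntI imageI rangeI)
  qed
  finally show ?thesis .
qed

section \<open>Minimal dilations of isometric restrictions\<close>

text \<open>Compressing \<open>V k\<close> to the embedded \<open>M\<close> already preserves norms,
  so \<open>V k\<close> maps the embedded \<open>M\<close> into itself. The embedded
  \<open>M\<close> therefore contains every vector whose closed span is the dilation space, and
  minimality makes it everything.\<close>

lemma
  assumes V: "minimal_row_isometric_dilation M \<iota> X V"
    and S: "csubspace (\<iota> ` M)" "closed (\<iota> ` M)"
    and X: "\<And>k h. h \<in> M \<Longrightarrow> X k h \<in> M" "\<And>k h. h \<in> M \<Longrightarrow> norm (\<iota> (X k h)) = norm (\<iota> h)"
  shows dilation_of_isometry: "h \<in> M \<Longrightarrow> V k (\<iota> h) = \<iota> (X k h)"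
    and dilation_of_isometry_trivial: "\<iota> ` M = UNIV"
proof -
  have V\<iota>: "V k (\<iota> h) = \<iota> (X k h)" if h: "h \<in> M" for k h
  proof -
    \<comment> \<open>The dilation identity is used for the one-letter word only.\<close>
    have "projection (\<iota> ` M) (foldr V [k] (\<iota> h)) = \<iota> (foldr X [k] h)"
      using V h unfolding minimal_row_isometric_dilation_def by blast
    then have P: "projection (\<iota> ` M) (V k (\<iota> h)) = \<iota> (X k h)" by simp
    have "norm (V k (\<iota> h)) = norm (\<iota> h)"
      using V by (simp add: minimal_row_isometric_dilation_def row_isometry_def isometry_def)
    then show ?thesis
      using projection_eq_self_if_norm_eq[OF S, of "V k (\<iota> h)"] P X(2)[OF h] by simp
  qed
  then show "h \<in> M \<Longrightarrow> V k (\<iota> h) = \<iota> (X k h)" .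
  have "foldr V \<alpha> (\<iota> h) \<in> \<iota> ` M" if "h \<in> M" for \<alpha> h
    using that by (induction \<alpha>) (auto simp: V\<iota> X(1))
  then have "cspan {foldr V \<alpha> (\<iota> h) | \<alpha> h. h \<in> M} \<subseteq> \<iota> ` M"
    unfolding cspan_def by (intro module.span_minimal[OF module_scaleC] S) auto
  then have "closure (cspan {foldr V \<alpha> (\<iota> h) | \<alpha> h. h \<in> M}) \<subseteq> \<iota> ` M"
    using S(2) by (rule closure_minimal)
  then show "\<iota> ` M = UNIV"
    using V by (auto simp: minimal_row_isometric_dilation_def)
qed

section \<open>Factorization of the meet through an inner multiplier\<close>

theorem theorem6p11:
  fixes F :: "('d :: finite, 'f :: complex_hilbert) fock \<Rightarrow> ('d, 'j :: complex_hilbert) fock"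
    and G :: "('d, 'g :: complex_hilbert) fock \<Rightarrow> ('d, 'j) fock"
    and H :: "('d, 'h :: complex_hilbert) fock \<Rightarrow> ('d, 'j) fock"
    and \<iota> :: "('d, 'j) fock \<Rightarrow> 'm :: complex_hilbert"
    and V :: "'d \<Rightarrow> 'm \<Rightarrow> 'm"
    and U :: "('d, 'h) fock \<Rightarrow> 'm"
  assumes "left_multiplier F" and "left_multiplier G"
    and "is_meet F G \<iota> V U H"
    and "inj F" and "inj G"
  shows "left_multiplier H \<and> inj H \<and>
    (\<exists>\<Gamma> :: ('d, 'h) fock \<Rightarrow> ('d, 'f \<times> 'g) fock.
       inner_multiplier \<Gamma> \<and>
       block_col H (\<lambda>x. - H x) = block_diag F G \<circ> \<Gamma> \<and>
       range \<Gamma> = ker (block_row F G))"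
proof -
  define M where "M = meet_space F G"
  have Fb: "bounded_clinear F" and Gb: "bounded_clinear G"
    and FR: "\<And>k x. F (right_mult k x) = right_mult k (F x)"
    and GR: "\<And>k x. G (right_mult k x) = right_mult k (G x)"
    using assms(1,2) by (auto simp: left_multiplier_def)
  interpret F: bounded_linear F by (rule bounded_clinear_imp_bounded_linear[OF Fb])
  interpret G: bounded_linear G by (rule bounded_clinear_imp_bounded_linear[OF Gb])
  have FC: "F (c *\<^sub>C x) = c *\<^sub>C F x" and GC: "G (c *\<^sub>C y) = c *\<^sub>C G y" for c x y
    using Fb Gb by (auto simp: bounded_clinear_def)
  note meet = assms(3)[unfolded is_meet_def Let_def, folded M_def]
  have \<iota>: "hilbert_inclusion M (meet_norm F G) \<iota>"
    and V: "minimal_row_isometric_dilation M \<iota> right_mult V"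
    and U: "unitary U" and UR: "\<And>k x. U (right_mult k x) = V k (U x)"
    and HM: "\<And>x. H x \<in> M" and \<iota>H: "\<And>x. \<iota> (H x) = projection (\<iota> ` M) (U x)"
    using meet by auto
  have \<iota>_add: "\<iota> (x + y) = \<iota> x + \<iota> y" and \<iota>_scaleC: "\<iota> (c *\<^sub>C x) = c *\<^sub>C \<iota> x"
    if "x \<in> M" "y \<in> M" for x y c
    using \<iota> that by (auto simp: hilbert_inclusion_def)
  have U_add: "U (x + y) = U x + U y" and U_scaleC: "U (c *\<^sub>C x) = c *\<^sub>C U x"
    and U_norm: "norm (U x) = norm x" for x y c
    using U by (auto simp: unitary_def isometry_def bounded_clinear_def
        linear_simps bounded_linear.linear linear_add)
  have M: "csubspace M" unfolding M_def using Fb Gb by (rule csubspace_meet_space)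
  have norm_\<iota>: "(norm (\<iota> h))\<^sup>2 = (norm a)\<^sup>2 + (norm b)\<^sup>2" if "F a = h" "G b = h" for h a b
  proof -
    have "h \<in> M" using that by (metis IntI M_def meet_space_def rangeI)
    then show ?thesis
      using \<iota> meet_norm_squared[OF Fb assms(4) Gb assms(5) that] by (simp add: hilbert_inclusion_def)
  qed
  \<comment> \<open>\<open>inv\<close> is arbitrary off the range, so \<open>f\<close> and
    \<open>g\<close> are right inverses only on \<open>M\<close>.\<close>
  define f where "f = inv F"
  define g where "g = inv G"
  have f: "F (f h) = h" and g: "G (g h) = h" if "h \<in> M" for h
    using that by (auto simp: f_def g_def M_def meet_space_def f_inv_into_f)
  have fF: "f (F x) = x" and gG: "g (G y) = y" for x y
    using assms(4,5) by (simp_all add: f_def g_def)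
  \<comment> \<open>Since \<open>F\<close> and \<open>G\<close> commute with the shifts, shifting
    the preimages \<open>f h\<close> and \<open>g h\<close> gives preimages of the shifted
    vector.\<close>
  have RM: "right_mult k h \<in> M" if "h \<in> M" for k h
    unfolding M_def meet_space_def
    using FR[of k "f h"] GR[of k "g h"] f[OF that] g[OF that] by (metis IntI rangeI)
  have "norm (\<iota> (right_mult k h)) = norm (\<iota> h)" if h: "h \<in> M" for k h
  proof -
    have "(norm (\<iota> (right_mult k h)))\<^sup>2 = (norm (\<iota> h))\<^sup>2"
      using norm_\<iota>[OF f[OF h] g[OF h]]
        norm_\<iota>[of "right_mult k (f h)" "right_mult k h" "right_mult k (g h)"]
      by (simp add: FR GR f[OF h] g[OF h] norm_right_mult)
    then show ?thesis by simp
  qed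
  moreover have "csubspace (\<iota> ` M)"
    unfolding csubspace_iff
  proof (intro conjI ballI allI)
    have 0: "0 \<in> M" using M by (simp add: csubspace_iff)
    show "0 \<in> \<iota> ` M" using \<iota>_add[OF 0 0] 0 by (auto intro: rev_image_eqI)
    fix x y c assume "x \<in> \<iota> ` M" "y \<in> \<iota> ` M"
    then obtain a b where ab: "x = \<iota> a" "y = \<iota> b" "a \<in> M" "b \<in> M" by blast
    then have "a + b \<in> M" using M by (auto simp: csubspace_iff)
    then show "x + y \<in> \<iota> ` M" using \<iota>_add ab by (metis imageI)
  next
    fix x c assume "x \<in> \<iota> ` M"
    then obtain a where a: "x = \<iota> a" "a \<in> M" by blast
    then have "c *\<^sub>C a \<in> M" using M by (auto simp: csubspace_iff)
    then show "c *\<^sub>C x \<in> \<iota> ` M" using \<iota>_scaleC a by (metis imageI)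
  qed
  moreover have "closed (\<iota> ` M)"
    using closed_image_meet_space[OF Fb assms(4) Gb assms(5)] \<iota> by (simp add: M_def)
  ultimately have V\<iota>: "\<And>k h. h \<in> M \<Longrightarrow> V k (\<iota> h) = \<iota> (right_mult k h)" and UNIV: "\<iota> ` M = UNIV"
    using dilation_of_isometry[OF V] dilation_of_isometry_trivial[OF V] RM by metis+
  \<comment> \<open>The embedded \<open>M\<close> is the whole dilation space, so the projection in
    the definition of \<open>H\<close> disappears.\<close>
  have \<iota>H: "\<iota> (H x) = U x" for x
    unfolding \<iota>H UNIV by (intro projection_fixed) (auto simp: csubspace_iff)
  \<comment> \<open>If \<open>\<iota>\<close> kills \<open>x - y\<close>, both its preimages have
    norm zero, so \<open>x - y\<close> is the image of 0 under \<open>F\<close>.\<close>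
  have \<iota>_inj: "x = y" if "\<iota> x = \<iota> y" "x \<in> M" "y \<in> M" for x y
  proof -
    have xy: "x - y \<in> M" using csubspace_diff[OF M] that by blast
    have "\<iota> (x - y) = 0" using \<iota>_add[OF xy that(3)] that(1) by simp
    then have "f (x - y) = 0" using norm_\<iota>[OF f[OF xy] g[OF xy]]
      by (simp add: add_nonneg_eq_0_iff)
    then show ?thesis using f[OF xy] F.zero by simp
  qed
  \<comment> \<open>Linearity and shift-equivariance pass from \<open>U\<close> to \<open>H\<close>
    by comparing both sides under \<open>\<iota>\<close>, which is injective on
    \<open>M\<close>.\<close>
  have H_add: "H (x + y) = H x + H y" for x y
    using \<iota>_add[OF HM HM] HM M
    by (intro \<iota>_inj) (auto simp: \<iota>H U_add csubspace_iff)
  have H_scaleC: "H (c *\<^sub>C x) = c *\<^sub>C H x" for c x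
    using \<iota>_scaleC[OF HM HM] HM M
    by (intro \<iota>_inj) (auto simp: \<iota>H U_scaleC csubspace_iff)
  have H_right: "H (right_mult k x) = right_mult k (H x)" for k x
    using V\<iota>[OF HM] RM HM by (intro \<iota>_inj) (auto simp: \<iota>H UR)
  \<comment> \<open>The minus sign places the values in the kernel of the row and produces the entry
    \<open>- H x\<close> in the block identity.\<close>
  define \<Gamma> where "\<Gamma> x = fock_pair (f (H x)) (- g (H x))" for x
  \<comment> \<open>Each right-hand side is a preimage of the vector on the left, and preimages are
    unique.\<close>
  have fH: "f (H (x + y)) = f (H x) + f (H y)" "f (H (c *\<^sub>C x)) = c *\<^sub>C f (H x)"
      "f (H (right_mult k x)) = right_mult k (f (H x))"
    and gH: "g (H (x + y)) = g (H x) + g (H y)" "g (H (c *\<^sub>C x)) = c *\<^sub>C g (H x)"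
      "g (H (right_mult k x)) = right_mult k (g (H x))" for x y c k
    using fF[of "f (H x) + f (H y)"] fF[of "c *\<^sub>C f (H x)"] fF[of "right_mult k (f (H x))"]
      gG[of "g (H x) + g (H y)"] gG[of "c *\<^sub>C g (H x)"] gG[of "right_mult k (g (H x))"]
    by (simp_all add: F.add G.add FC GC FR GR f g HM H_add H_scaleC H_right)
  have scaleC_minus: "c *\<^sub>C (- x) = - (c *\<^sub>C x)" for c and x :: "('d, 'g) fock"
    by (simp add: scaleC_scaleC flip: scaleC_minus_one)
  \<comment> \<open>The pair of preimages has the meet norm of \<open>H x\<close>, which is the norm
    of \<open>\<iota> (H x) = U x\<close>, and \<open>U\<close> is isometric.\<close>
  have \<Gamma>_norm: "norm (\<Gamma> x) = norm x" for x
  proof -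
    have "(norm (\<Gamma> x))\<^sup>2 = (norm (U x))\<^sup>2"
      using norm_\<iota>[OF f[OF HM] g[OF HM], of x] by (simp add: \<Gamma>_def norm_fock_pair \<iota>H)
    then show ?thesis by (simp add: U_norm)
  qed
  have \<Gamma>: "bounded_clinear \<Gamma>"
  proof (rule bounded_clinearI[where B = 1])
    show "\<Gamma> (x + y) = \<Gamma> x + \<Gamma> y" for x y
      by (simp add: \<Gamma>_def fH gH flip: fock_pair_add)
    show "\<Gamma> (c *\<^sub>C x) = c *\<^sub>C \<Gamma> x" for c x
      by (simp add: \<Gamma>_def fH gH scaleC_minus flip: fock_pair_scaleC)
  qed (simp add: \<Gamma>_norm)
  have "\<Gamma> (right_mult k x) = right_mult k (\<Gamma> x)" for k x
    by (simp add: \<Gamma>_def fH gH right_mult_minus flip: fock_pair_right_mult)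
  then have "inner_multiplier \<Gamma>"
    using \<Gamma> \<Gamma>_norm by (simp add: inner_multiplier_def left_multiplier_def isometry_def)
  moreover have "block_col H (\<lambda>x. - H x) = block_diag F G \<circ> \<Gamma>"
    by (simp add: fun_eq_iff block_col_def block_diag_def \<Gamma>_def f g HM G.neg)
  moreover have "range \<Gamma> = ker (block_row F G)"
  proof (intro equalityI subsetI)
    fix z assume "z \<in> ker (block_row F G)"
    then have FG: "F (fock_fst z) = G (- fock_snd z)"
      by (simp add: ker_def block_row_def G.neg eq_neg_iff_add_eq_0)
    have zM: "F (fock_fst z) \<in> M"
      unfolding M_def meet_space_def using FG by (metis IntI rangeI)
    \<comment> \<open>Surjectivity of \<open>U\<close> supplies the vector; injectivity of
      \<open>\<iota>\<close> on \<open>M\<close> then identifies \<open>H x\<close>.\<close>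
    obtain x where x: "U x = \<iota> (F (fock_fst z))" using U by (metis unitary_def surjD)
    then have Hx: "H x = F (fock_fst z)" using HM zM by (intro \<iota>_inj) (simp_all add: \<iota>H)
    have "g (H x) = - fock_snd z" unfolding Hx FG gG ..
    then have "\<Gamma> x = z" by (simp add: \<Gamma>_def) (simp add: Hx fF)
    then show "z \<in> range \<Gamma>" by blast
  qed (auto simp: ker_def block_row_def \<Gamma>_def f g HM G.neg)
  moreover have "left_multiplier H"
  proof -
    \<comment> \<open>Boundedness of \<open>H\<close> is read off from the first block entry, since
      \<open>F (f (H x)) = H x\<close>.\<close>
    have "bounded_clinear (\<lambda>x. F (fock_fst (\<Gamma> x)))"
      using bounded_clinear_compose[OF Fb bounded_clinear_compose[OF bounded_clinear_fock_fst \<Gamma>]] .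
    then show ?thesis by (simp add: left_multiplier_def H_right \<Gamma>_def f HM)
  qed
  moreover have "inj H"
  proof (rule injI)
    fix x y assume "H x = H y"
    \<comment> \<open>\<open>\<Gamma>\<close> depends on its argument only through \<open>H\<close>,
      so injectivity of \<open>H\<close> follows from \<open>\<Gamma>\<close> being
      isometric.\<close>
    then have "\<Gamma> (x - y) = 0"
      using \<Gamma> by (simp add: bounded_clinear_def linear_simps) (simp add: \<Gamma>_def)
    then show "x = y" using \<Gamma>_norm[of "x - y"] by simp
  qed
  ultimately show ?thesis by blast
qed

end
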